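(* For every normed space $X$, set \[ \mathcal F_{\rm ax}:=\{C^{\rm ax}(u,f,\delta):(u,f)\text{ norming},\ \delta>0\},\qquad \mathcal F_{\rm n}:=\{C^{\rm n}(u,f,r):(u,f)\text{ norming},\ 0<r<1\}. \] Both families are directionally fine, and $\mathcal F_{\rm ax}$ is convex directionally fine. More precisely, for $0<\varepsilon<1$, if $0<\delta<\varepsilon$ then $C^{\rm ax}(u,f,\delta)\subset\operatorname{cone}B(u,\varepsilon)$, whereas $0<r<\varepsilon/(1+\varepsilon)$ implies $C^{\rm n}(u,f,r)\subset\operatorname{cone}B(u,\varepsilon)$. Moreover, \[ C^{\rm ax}(u,f,\delta)=\operatorname{cone}\bigl((u+\ker f)\cap B(u,\delta)\bigr). \] Similarly, \[ C^{\rm n}(u,f,r)=\operatorname{cone}\bigl((u+\ker f)\cap\{z:\|z-u\|\le r\|z\|\}\bigr). \] If $X=H$ is a Hilbert space, then $C^{\rm n}(u,f,r)=C^{\rm ax}\bigl(u,f,r/\sqrt{1-r^2}\bigr)$; hence the two constructions generate the same family up to reparametrization. In general normed spaces they need not coincide.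
   Context: $X$ is a real normed space with continuous dual $X^*$; $S_X$, $S_{X^*}$ are the unit spheres of $X$ and $X^*$, $B(x,r)=\{y\in X:\|y-x\|\le r\}$, and $\operatorname{cone}(A)=\{ta:t\ge0,\ a\in A\}$. A cone is a nonempty set $C\subset X$ with $tC\subset C$ for all $t\ge0$; cones are assumed proper, i.e. $\{0\}\subsetneq C\subsetneq X$. A norming pair is a pair $(u,f)\in S_X\times S_{X^*}$ with $f(u)=1$; put $Q_{u,f}x:=x-f(x)u$. For a norming pair $(u,f)$, the uniform axial deviation cone is $C^{\rm ax}(u,f,\delta):=\{x\in X:f(x)-\delta^{-1}\|Q_{u,f}x\|\ge0\}$, $\delta>0$, and the norm-normalized axial cone is $C^{\rm n}(u,f,r):=\{x\in X:f(x)\ge0,\ \|Q_{u,f}x\|\le r\|x\|\}$. Throughout the claim, $(u,f)$ is a norming pair, $\delta>0$ and $0<r<1$. A family $\mathcal F$ of closed cones in $X$ is directionally fine if for every $u\in S_X$ and $\varepsilon\in(0,1)$ there exists $C\in\mathcal F$ with $u\in\operatorname{int}C\subset C\subset\operatorname{cone}B(u,\varepsilon)$; it is convex directionally fine if $C$ can always be chosen convex. *)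

theory Defs
  imports "HOL-Analysis.Analysis"
begin

text \<open>The dual space is the type of bounded linear functionals
  \<^typ>\<open>'a \<Rightarrow>\<^sub>L real\<close> with the operator norm.\<close>

definition norming_pair :: "'a::real_normed_vector \<Rightarrow> ('a \<Rightarrow>\<^sub>L real) \<Rightarrow> bool" where
  "norming_pair u f \<longleftrightarrow> u \<in> sphere 0 1 \<and> f \<in> sphere 0 1 \<and> blinfun_apply f u = 1"

definition Q_map :: "'a::real_normed_vector \<Rightarrow> ('a \<Rightarrow>\<^sub>L real) \<Rightarrow> 'a \<Rightarrow> 'a" where
  "Q_map u f x = x - blinfun_apply f x *\<^sub>R u"

definition ker :: "('a::real_normed_vector \<Rightarrow>\<^sub>L real) \<Rightarrow> 'a set" where
  "ker f = {x. blinfun_apply f x = 0}"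

definition cone_of :: "'a::real_vector set \<Rightarrow> 'a set" where
  "cone_of A = {t *\<^sub>R a | t a. 0 \<le> t \<and> a \<in> A}"

lemma cone_of_eq_cone_hull: "cone_of A = cone hull A"
  by (simp add: cone_of_def cone_hull_expl)

definition proper_cone :: "'a::real_vector set \<Rightarrow> bool" where
  "proper_cone C \<longleftrightarrow> C \<noteq> {} \<and> cone C \<and> {0} \<subset> C \<and> C \<subset> UNIV"

definition C_ax :: "'a::real_normed_vector \<Rightarrow> ('a \<Rightarrow>\<^sub>L real) \<Rightarrow> real \<Rightarrow> 'a set" where
  "C_ax u f \<delta> = {x. blinfun_apply f x - inverse \<delta> * norm (Q_map u f x) \<ge> 0}"

definition C_n :: "'a::real_normed_vector \<Rightarrow> ('a \<Rightarrow>\<^sub>L real) \<Rightarrow> real \<Rightarrow> 'a set" where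
  "C_n u f r = {x. blinfun_apply f x \<ge> 0 \<and> norm (Q_map u f x) \<le> r * norm x}"

definition F_ax :: "'a::real_normed_vector set set" where
  "F_ax = {C_ax u f \<delta> | u f \<delta>. norming_pair u f \<and> 0 < \<delta>}"

definition F_n :: "'a::real_normed_vector set set" where
  "F_n = {C_n u f r | u f r. norming_pair u f \<and> 0 < r \<and> r < 1}"

text \<open>Both notions of fineness are properties of families of closed proper cones, so that
  requirement on all members is part of the definitions.\<close>

definition directionally_fine :: "'a::real_normed_vector set set \<Rightarrow> bool" where
  "directionally_fine \<F> \<longleftrightarrow>
     (\<forall>C\<in>\<F>. closed C \<and> proper_cone C) \<and>
     (\<forall>u\<in>sphere 0 1. \<forall>\<epsilon>\<in>{0<..<1}. \<exists>C\<in>\<F>.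
        u \<in> interior C \<and> interior C \<subseteq> C \<and> C \<subseteq> cone_of (cball u \<epsilon>))"

definition convex_directionally_fine :: "'a::real_normed_vector set set \<Rightarrow> bool" where
  "convex_directionally_fine \<F> \<longleftrightarrow>
     (\<forall>C\<in>\<F>. closed C \<and> proper_cone C) \<and>
     (\<forall>u\<in>sphere 0 1. \<forall>\<epsilon>\<in>{0<..<1}. \<exists>C\<in>\<F>. convex C \<and>
        u \<in> interior C \<and> interior C \<subseteq> C \<and> C \<subseteq> cone_of (cball u \<epsilon>))"

text \<open>The space of bounded real sequences with the supremum norm (\<^typ>\<open>nat\<close> carries the
  discrete topology).\<close>

type_synonym linfty = "nat \<Rightarrow>\<^sub>C real"

end

theory Submission
  imports Defs
begin

text \<open>
  Away from the origin, membership of \<open>x\<close> in either cone is decided on the slice \<open>f = 1\<close> by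
  \<open>z = x / f x\<close>: it says \<open>\<parallel>z - u\<parallel> \<le> \<delta>\<close>, respectively \<open>\<parallel>z - u\<parallel> \<le> r \<parallel>z\<parallel> \<le> r (1 + \<parallel>z - u\<parallel>)\<close>.
  Norming functionals exist by Hahn-Banach: a pointwise minimal sublinear functional is linear.
  In a Hilbert space \<open>f\<close> must be the inner product with \<open>u\<close>, and Pythagoras converts one cone into
  the other.  The axial cones are convex, while in \<open>\<ell>\<^sup>\<infinity>\<close> the cone \<open>C\<^sup>n\<close> for
  \<open>u = (1, 1, \<dots>)\<close>, \<open>f = e\<^sub>0\<close>, \<open>r = 1/2\<close> is not, which separates the two families.
\<close>

section \<open>Norming functionals\<close>

definition sublinear :: "('a::real_vector \<Rightarrow> real) \<Rightarrow> bool" where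
  "sublinear q \<longleftrightarrow> (\<forall>x y. q (x + y) \<le> q x + q y) \<and> (\<forall>t>0. \<forall>x. q (t *\<^sub>R x) = t * q x)"

text \<open>The largest sublinear functional below \<open>q\<close> whose value at \<open>- a\<close> is at most \<open>- q a\<close>.\<close>

definition tilt :: "('a::real_vector \<Rightarrow> real) \<Rightarrow> 'a \<Rightarrow> 'a \<Rightarrow> real" where
  "tilt q a x = (INF t\<in>{0..}. q (x + t *\<^sub>R a) - t * q a)"

lemma sublinear_add: "sublinear q \<Longrightarrow> q (x + y) \<le> q x + q y"
  by (simp add: sublinear_def)

lemma sublinear_scale: "sublinear q \<Longrightarrow> 0 < t \<Longrightarrow> q (t *\<^sub>R x) = t * q x"
  by (simp add: sublinear_def)

lemma sublinear_zero: "sublinear q \<Longrightarrow> q 0 = 0"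
  using sublinear_scale[of q 2 0] by simp

lemma sublinear_scale_nonneg: "sublinear q \<Longrightarrow> 0 \<le> t \<Longrightarrow> q (t *\<^sub>R x) = t * q x"
  by (cases "t = 0") (auto simp: sublinear_zero sublinear_scale)

lemma sublinear_minus: "sublinear q \<Longrightarrow> - q (- x) \<le> q x"
  using sublinear_add[of q x "- x"] sublinear_zero[of q] by simp

text \<open>Subadditivity for t a = (x + t a) + (- x). The bound does not depend on
  \<open>t\<close>, so the infimum in \<open>tilt\<close> is a genuine one over a set bounded
  below.\<close>

lemma tilt_lower:
  assumes "sublinear q" "0 \<le> t"
  shows "- q (- x) \<le> q (x + t *\<^sub>R a) - t * q a"
  using sublinear_add[OF assms(1), of "x + t *\<^sub>R a" "- x"] sublinear_scale_nonneg[OF assms, of a]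
  by simp

lemma tilt_le:
  assumes "sublinear q" "0 \<le> t"
  shows "tilt q a x \<le> q (x + t *\<^sub>R a) - t * q a"
  unfolding tilt_def
  by (rule cINF_lower) (auto intro!: bdd_belowI2[where m = "- q (- x)"] tilt_lower assms)

lemma tilt_greatest:
  assumes "\<And>t. 0 \<le> t \<Longrightarrow> c \<le> q (x + t *\<^sub>R a) - t * q a"
  shows "c \<le> tilt q a x"
  unfolding tilt_def by (rule cINF_greatest) (auto intro: assms)

lemma tilt_le_self: "sublinear q \<Longrightarrow> tilt q a x \<le> q x"
  using tilt_le[of q 0 a x] by simp

lemma tilt_uminus: "sublinear q \<Longrightarrow> tilt q a (- a) \<le> - q a"
  using tilt_le[of q 1 a "- a"] by (simp add: sublinear_zero)

text \<open>Competitors with parameters s and t for x and y add up to the competitor s + t for x +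
  y. Scaling by s > 0 turns the competitor t / s for x into the competitor t for s x.\<close>

lemma sublinear_tilt:
  assumes q: "sublinear q"
  shows "sublinear (tilt q a)"
proof -
  have add: "tilt q a (x + y) \<le> tilt q a x + tilt q a y" for x y
  proof -
    have *: "tilt q a (x + y) \<le> (q (x + s *\<^sub>R a) - s * q a) + (q (y + t *\<^sub>R a) - t * q a)"
      if "0 \<le> s" "0 \<le> t" for s t
    proof -
      have "tilt q a (x + y) \<le> q (x + y + (s + t) *\<^sub>R a) - (s + t) * q a"
        using that by (intro tilt_le q) auto
      moreover have "q (x + y + (s + t) *\<^sub>R a) \<le> q (x + s *\<^sub>R a) + q (y + t *\<^sub>R a)"
        using sublinear_add[OF q, of "x + s *\<^sub>R a" "y + t *\<^sub>R a"] by (simp add: algebra_simps)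
      ultimately show ?thesis by (simp add: algebra_simps)
    qed
    \<comment> \<open>The two infima are taken one after the other: first over \<open>s\<close> with
      \<open>t\<close> fixed, then over \<open>t\<close>.\<close>
    have "tilt q a (x + y) - tilt q a x \<le> q (y + t *\<^sub>R a) - t * q a" if "0 \<le> t" for t
    proof -
      have "tilt q a (x + y) - (q (y + t *\<^sub>R a) - t * q a) \<le> tilt q a x"
        using *[OF _ that] by (intro tilt_greatest) (simp add: algebra_simps)
      then show ?thesis by simp
    qed
    then have "tilt q a (x + y) - tilt q a x \<le> tilt q a y"
      by (rule tilt_greatest)
    then show ?thesis by simp
  qed
  have le: "s * tilt q a x \<le> tilt q a (s *\<^sub>R x)" if s: "0 < s" for s x
  proof (rule tilt_greatest)
    fix t :: real
    assume t: "0 \<le> t"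
    have "s * tilt q a x \<le> s * (q (x + (t / s) *\<^sub>R a) - (t / s) * q a)"
      using s t by (intro mult_left_mono tilt_le q) auto
    also have "\<dots> = q (s *\<^sub>R (x + (t / s) *\<^sub>R a)) - t * q a"
      using s by (simp add: sublinear_scale[OF q] right_diff_distrib)
    also have "s *\<^sub>R (x + (t / s) *\<^sub>R a) = s *\<^sub>R x + t *\<^sub>R a"
      using s by (simp add: scaleR_add_right)
    finally show "s * tilt q a x \<le> q (s *\<^sub>R x + t *\<^sub>R a) - t * q a" .
  qed
  have "tilt q a (s *\<^sub>R x) = s * tilt q a x" if s: "0 < s" for s x
  proof (rule antisym)
    show "s * tilt q a x \<le> tilt q a (s *\<^sub>R x)" by (rule le[OF s])
    \<comment> \<open>The reverse inequality is the first one applied to 1 / s and s x.\<close>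
    have "inverse s * tilt q a (s *\<^sub>R x) \<le> tilt q a x"
      using le[of "inverse s" "s *\<^sub>R x"] s by simp
    then show "tilt q a (s *\<^sub>R x) \<le> s * tilt q a x"
      using s by (simp add: field_simps)
  qed
  with add show ?thesis by (simp add: sublinear_def)
qed

section \<open>Hahn-Banach by Zorn's lemma\<close>

lemma sublinear_chain_INF:
  fixes C :: "('a::real_vector \<Rightarrow> real) set"
  assumes ne: "C \<noteq> {}" and sub: "\<And>q. q \<in> C \<Longrightarrow> sublinear q"
    and chain: "\<And>q r. q \<in> C \<Longrightarrow> r \<in> C \<Longrightarrow> q \<le> r \<or> r \<le> q"
    and bdd: "\<And>x. bdd_below ((\<lambda>q. q x) ` C)"
  shows "sublinear (\<lambda>x. INF q\<in>C. q x)"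
proof -
  let ?m = "\<lambda>x. INF q\<in>C. q x"
  have low: "?m x \<le> q x" if "q \<in> C" for q x
    by (rule cINF_lower[OF bdd that])
  have add: "?m (x + y) \<le> ?m x + ?m y" for x y
  proof -
    have *: "?m (x + y) \<le> q x + r y" if qr: "q \<in> C" "r \<in> C" for q r
    proof -
      \<comment> \<open>Comparability replaces two members of the chain by the smaller one, and
        subadditivity of that single functional suffices.\<close>
      obtain s where s: "s \<in> C" "s \<le> q" "s \<le> r"
        using chain[OF qr] qr by auto
      have "?m (x + y) \<le> s (x + y)" by (rule low[OF s(1)])
      also have "\<dots> \<le> s x + s y" by (rule sublinear_add[OF sub[OF s(1)]])
      also have "\<dots> \<le> q x + r y" using s by (intro add_mono) (auto simp: le_fun_def)
      finally show ?thesis .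
    qed
    have "?m (x + y) - ?m x \<le> r y" if "r \<in> C" for r
    proof -
      have "?m (x + y) - r y \<le> ?m x"
        using *[OF _ that] by (intro cINF_greatest ne) (simp add: algebra_simps)
      then show ?thesis by simp
    qed
    then have "?m (x + y) - ?m x \<le> ?m y"
      by (intro cINF_greatest ne)
    then show ?thesis by simp
  qed
  have le: "s * ?m x \<le> ?m (s *\<^sub>R x)" if s: "0 < s" for s x
  proof (rule cINF_greatest[OF ne])
    fix q
    assume q: "q \<in> C"
    have "s * ?m x \<le> s * q x" using s low[OF q] by (intro mult_left_mono) auto
    then show "s * ?m x \<le> q (s *\<^sub>R x)" using sublinear_scale[OF sub[OF q] s] by simp
  qed
  have "?m (s *\<^sub>R x) = s * ?m x" if s: "0 < s" for s x
  proof (rule antisym)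
    show "s * ?m x \<le> ?m (s *\<^sub>R x)" by (rule le[OF s])
    have "inverse s * ?m (s *\<^sub>R x) \<le> ?m x"
      using le[of "inverse s" "s *\<^sub>R x"] s by simp
    then show "?m (s *\<^sub>R x) \<le> s * ?m x"
      using s by (simp add: field_simps)
  qed
  with add show ?thesis by (simp add: sublinear_def)
qed

text \<open>Zorn yields a minimal sublinear \<open>m\<close> below \<open>tilt p a\<close>.
  Minimality forces \<open>m\<close> to equal each of its own tilts, which makes it odd, and an odd
  sublinear functional is linear. Starting from \<open>tilt p a\<close> instead of \<open>p\<close>
  is what secures the value at \<open>a\<close>.\<close>

theorem hahn_banach_sublinear:
  assumes p: "sublinear p"
  obtains g where "linear g" "\<And>x. g x \<le> p x" "g a = p a"
proof -
  define A where "A = {q. sublinear q \<and> q \<le> tilt p a}"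
  \<comment> \<open>For every q in \<open>A\<close>, q x >= - q (- x) >= - tilt p a (- x), a bound
    uniform in q.\<close>
  have bdd: "bdd_below ((\<lambda>q. q x) ` C)" if "C \<subseteq> A" for C x
  proof (rule bdd_belowI2)
    fix q
    assume "q \<in> C"
    then have q: "sublinear q" "q \<le> tilt p a" using that by (auto simp: A_def)
    have "q (- x) \<le> tilt p a (- x)" using q(2) by (simp add: le_fun_def)
    then show "- tilt p a (- x) \<le> q x" using sublinear_minus[OF q(1), of x] by simp
  qed
  have "\<exists>m\<in>A. \<forall>q\<in>A. q \<le> m \<longrightarrow> q = m"
  \<comment> \<open>The order is reversed, so the maximal element supplied by Zorn is a minimal
    functional.\<close>
  proof (rule predicate_Zorn)
    show "partial_order_on A (relation_of (\<lambda>q r. r \<le> q) A)"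
      by (rule partial_order_on_relation_ofI) auto
    fix C
    assume "C \<in> Chains (relation_of (\<lambda>q r. r \<le> q) A)"
    then have chain: "q \<le> r \<or> r \<le> q" and sub: "q \<in> A" if "q \<in> C" "r \<in> C" for q r
      using that by (auto simp: Chains_def relation_of_def)
    have CA: "C \<subseteq> A" using sub by blast
    show "\<exists>m\<in>A. \<forall>q\<in>C. m \<le> q"
    proof (cases "C = {}")
      case True
      \<comment> \<open>The empty chain is bounded by \<open>tilt p a\<close> itself, which also
        shows that \<open>A\<close> is nonempty.\<close>
      then show ?thesis using sublinear_tilt[OF p] by (auto simp: A_def)
    next
      case False
      let ?m = "\<lambda>x. INF q\<in>C. q x"
      have low: "?m \<le> q" if "q \<in> C" for q
        using cINF_lower[OF bdd[OF CA] that] by (simp add: le_fun_def)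
      have "sublinear ?m"
        using CA by (intro sublinear_chain_INF False chain bdd) (auto simp: A_def)
      moreover have "?m \<le> tilt p a"
      proof -
        obtain q where q: "q \<in> C" using False by blast
        then have "q \<le> tilt p a" using CA by (auto simp: A_def)
        with low[OF q] show ?thesis by (rule order_trans)
      qed
      ultimately show ?thesis using low by (auto simp: A_def)
    qed
  qed
  then obtain m where mA: "m \<in> A" and min: "\<And>q. q \<in> A \<Longrightarrow> q \<le> m \<Longrightarrow> q = m"
    by blast
  have m: "sublinear m" and mt: "\<And>x. m x \<le> tilt p a x"
    using mA by (auto simp: A_def le_fun_def)
  have neg: "m (- b) = - m b" for b
  proof -
    have le: "tilt m b \<le> m" by (simp add: le_fun_def tilt_le_self[OF m])
    then have "tilt m b \<in> A"
      using sublinear_tilt[OF m] mA by (auto simp: A_def intro: order_trans)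
    from min[OF this le] have "m (- b) \<le> - m b" using tilt_uminus[OF m, of b] by simp
    then show ?thesis using sublinear_minus[OF m, of b] by simp
  qed
  have "linear m"
  proof (rule linearI)
    fix x y
    have "m (- x + - y) \<le> m (- x) + m (- y)" by (rule sublinear_add[OF m])
    then have "m x + m y \<le> m (x + y)" using neg[of "x + y"] neg[of x] neg[of y] by simp
    then show "m (x + y) = m x + m y" using sublinear_add[OF m, of x y] by simp
  next
    fix t x
    show "m (t *\<^sub>R x) = t *\<^sub>R m x"
    proof (cases "0 \<le> t")
      case True
      then show ?thesis by (simp add: sublinear_scale_nonneg[OF m])
    next
      case False
      then show ?thesis
        using sublinear_scale_nonneg[OF m, of "- t" x] neg[of "t *\<^sub>R x"] by simp
    qed
  qed
  moreover have le: "m x \<le> p x" for x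
    using mt[of x] tilt_le_self[OF p, of a x] by simp
  \<comment> \<open>By oddness, - m a = m (- a) <= tilt p a (- a) <= - p a.\<close>
  moreover have "m a = p a"
    using mt[of "- a"] tilt_uminus[OF p, of a] neg[of a] le[of a] by simp
  ultimately show thesis by (rule that)
qed

text \<open>Hahn-Banach with the norm as the sublinear functional: domination at x and - x bounds
  the absolute value by the norm, and equality at \<open>u\<close> makes the operator norm exactly
  1.\<close>

lemma norming_pair_exists:
  fixes u :: "'a::real_normed_vector"
  assumes "norm u = 1"
  obtains f where "norming_pair u f"
proof -
  have "sublinear (norm :: 'a \<Rightarrow> real)"
    by (simp add: sublinear_def norm_triangle_ineq)
  then obtain g where g: "linear g" "\<And>x. g x \<le> norm x" "g u = norm u"
    using hahn_banach_sublinear by metis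
  interpret linear g by fact
  have abs: "\<bar>g x\<bar> \<le> norm x" for x
    using g(2)[of x] g(2)[of "- x"] by (simp add: neg)
  have bl: "bounded_linear g"
    using abs by (intro bounded_linear_intro[where K = 1]) (auto simp: add scaleR)
  have "norm (Blinfun g) = 1"
    using abs g(3) assms
    by (intro norm_blinfun_eqI[where x = u]) (auto simp: bounded_linear_Blinfun_apply[OF bl])
  then show thesis
    using that[of "Blinfun g"] g(3) assms
    by (simp add: norming_pair_def bounded_linear_Blinfun_apply[OF bl])
qed

section \<open>Axial cones in normed spaces\<close>

lemma norming_pairD:
  assumes "norming_pair u f"
  shows "norm u = 1" "norm f = 1" "blinfun_apply f u = 1"
  using assms by (auto simp: norming_pair_def)

lemma Q_map_add: "Q_map u f (x + y) = Q_map u f x + Q_map u f y"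
  by (simp add: Q_map_def blinfun.add_right algebra_simps)

lemma Q_map_scaleR: "Q_map u f (t *\<^sub>R x) = t *\<^sub>R Q_map u f x"
  by (simp add: Q_map_def blinfun.scaleR_right algebra_simps)

lemma Q_map_self: "norming_pair u f \<Longrightarrow> Q_map u f u = 0"
  by (simp add: Q_map_def norming_pairD)

lemma continuous_on_Q_map [continuous_intros]: "continuous_on S (Q_map u f)"
  unfolding Q_map_def by (intro continuous_intros)

lemma mem_slice_iff: "norming_pair u f \<Longrightarrow> z \<in> (+) u ` ker f \<longleftrightarrow> blinfun_apply f z = 1"
  by (force simp: ker_def image_iff norming_pairD blinfun.add_right blinfun.diff_right
      intro: exI[of _ "z - u"])

lemma cone_of_mono: "A \<subseteq> B \<Longrightarrow> cone_of A \<subseteq> cone_of B"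
  by (auto simp: cone_of_def)

lemma C_ax_iff: "0 < \<delta> \<Longrightarrow> x \<in> C_ax u f \<delta> \<longleftrightarrow> norm (Q_map u f x) \<le> \<delta> * blinfun_apply f x"
  by (simp add: C_ax_def field_simps)

text \<open>Shared reduction for both kinds of cone: a nonzero x in \<open>C\<close> has f x > 0, so
  x / f x lies on the slice, where membership in \<open>C\<close> is membership in
  \<open>D\<close>.\<close>

lemma cone_eq_cone_of_slice:
  assumes np: "norming_pair u f" and C: "cone C" "0 \<in> C"
    and pos: "\<And>x. x \<in> C \<Longrightarrow> x \<noteq> 0 \<Longrightarrow> 0 < blinfun_apply f x"
    and slice: "\<And>z. blinfun_apply f z = 1 \<Longrightarrow> z \<in> C \<longleftrightarrow> z \<in> D" and "u \<in> D"
  shows "C = cone_of ((+) u ` ker f \<inter> D)"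
proof (intro equalityI subsetI)
  fix x
  assume x: "x \<in> C"
  show "x \<in> cone_of ((+) u ` ker f \<inter> D)"
  proof (cases "x = 0")
    case True
    \<comment> \<open>The origin is 0 times a slice point, so some slice point must exist;
      \<open>u\<close> is one.\<close>
    have "u \<in> (+) u ` ker f \<inter> D"
      using \<open>u \<in> D\<close> mem_slice_iff[OF np] norming_pairD[OF np] by auto
    moreover have "x = 0 *\<^sub>R u" using True by simp
    ultimately show ?thesis unfolding cone_of_def by blast
  next
    case False
    define c where "c = blinfun_apply f x"
    define z where "z = inverse c *\<^sub>R x"
    have c: "0 < c" unfolding c_def by (rule pos[OF x False])
    have fz: "blinfun_apply f z = 1" using c by (simp add: z_def blinfun.scaleR_right c_def)
    have "z \<in> C" using C(1) x c by (simp add: z_def cone_def)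
    then have "z \<in> (+) u ` ker f \<inter> D" using slice fz mem_slice_iff[OF np] by auto
    moreover have "x = c *\<^sub>R z" "0 \<le> c" using c by (auto simp: z_def)
    ultimately show ?thesis unfolding cone_of_def by blast
  qed
next
  fix x
  assume "x \<in> cone_of ((+) u ` ker f \<inter> D)"
  then obtain t z where "x = t *\<^sub>R z" "0 \<le> t" "blinfun_apply f z = 1" "z \<in> D"
    using mem_slice_iff[OF np] by (auto simp: cone_of_def)
  then show "x \<in> C" using C(1) slice by (simp add: cone_def)
qed

lemma cone_C_ax: "0 < \<delta> \<Longrightarrow> cone (C_ax u f \<delta>)"
  by (auto simp: cone_def C_ax_iff Q_map_scaleR blinfun.scaleR_right mult.left_commute[of \<delta>]
      intro: mult_left_mono)

lemma cone_C_n: "cone (C_n u f r)"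
  by (auto simp: cone_def C_n_def Q_map_scaleR blinfun.scaleR_right mult.left_commute[of r]
      intro: mult_left_mono)

lemma C_ax_eq_cone_of:
  assumes np: "norming_pair u f" and \<delta>: "0 < \<delta>"
  shows "C_ax u f \<delta> = cone_of ((+) u ` ker f \<inter> cball u \<delta>)"
proof (rule cone_eq_cone_of_slice[OF np cone_C_ax[OF \<delta>]])
  show "0 \<in> C_ax u f \<delta>" by (simp add: C_ax_def Q_map_def)
  show "u \<in> cball u \<delta>" using \<delta> by simp
  show "z \<in> C_ax u f \<delta> \<longleftrightarrow> z \<in> cball u \<delta>" if "blinfun_apply f z = 1" for z
    using that \<delta> by (simp add: C_ax_iff Q_map_def dist_norm norm_minus_commute)
  \<comment> \<open>Membership gives f x >= 0. If f x = 0, then \<open>Q_map u f x\<close> is x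
    itself and has norm at most 0.\<close>
  show "0 < blinfun_apply f x" if x: "x \<in> C_ax u f \<delta>" "x \<noteq> 0" for x
  proof (rule ccontr)
    assume "\<not> 0 < blinfun_apply f x"
    moreover have *: "norm (Q_map u f x) \<le> \<delta> * blinfun_apply f x" using x(1) \<delta> by (simp add: C_ax_iff)
    moreover have "0 \<le> \<delta> * blinfun_apply f x" by (rule order_trans[OF norm_ge_zero *])
    ultimately have "blinfun_apply f x = 0" using \<delta> by (simp add: zero_le_mult_iff)
    with * x(2) show False by (simp add: Q_map_def)
  qed
qed

lemma C_n_eq_cone_of:
  assumes np: "norming_pair u f" and r: "0 < r" "r < 1"
  shows "C_n u f r = cone_of ((+) u ` ker f \<inter> {z. norm (z - u) \<le> r * norm z})"
proof (rule cone_eq_cone_of_slice[OF np cone_C_n])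
  show "0 \<in> C_n u f r" by (simp add: C_n_def Q_map_def)
  show "u \<in> {z. norm (z - u) \<le> r * norm z}" using r by simp
  show "z \<in> C_n u f r \<longleftrightarrow> z \<in> {z. norm (z - u) \<le> r * norm z}" if "blinfun_apply f z = 1" for z
    using that by (simp add: C_n_def Q_map_def)
  \<comment> \<open>If f x = 0, then \<open>Q_map u f x\<close> is x, and norm x <= r norm x with r
    < 1 leaves only x = 0.\<close>
  show "0 < blinfun_apply f x" if x: "x \<in> C_n u f r" "x \<noteq> 0" for x
  proof (rule ccontr)
    assume "\<not> 0 < blinfun_apply f x"
    with x(1) have "norm x \<le> r * norm x" by (auto simp: C_n_def Q_map_def)
    with x(2) r show False by simp
  qed
qed

section \<open>Inclusions into cones over balls\<close>

lemma C_ax_subset_cone_of_cball: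
  assumes "norming_pair u f" "0 < \<delta>" "\<delta> < \<epsilon>"
  shows "C_ax u f \<delta> \<subseteq> cone_of (cball u \<epsilon>)"
  unfolding C_ax_eq_cone_of[OF assms(1,2)] by (rule cone_of_mono) (use assms in auto)

text \<open>On the slice, norm z <= norm (z - u) + 1 yields norm (z - u) <= r / (1 - r). This
  quotient is below \<epsilon> exactly when r < \<epsilon> / (1 + \<epsilon>), which explains the
  threshold.\<close>

lemma C_n_subset_cone_of_cball:
  assumes np: "norming_pair u f" and "0 < \<epsilon>" "0 < r" "r < \<epsilon> / (1 + \<epsilon>)"
  shows "C_n u f r \<subseteq> cone_of (cball u \<epsilon>)"
proof -
  have r: "r * (1 + \<epsilon>) < \<epsilon>" using assms by (simp add: field_simps)
  have "\<epsilon> / (1 + \<epsilon>) < 1" using \<open>0 < \<epsilon>\<close> by simp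
  with assms have "r < 1" by linarith
  have "z \<in> cball u \<epsilon>" if z: "norm (z - u) \<le> r * norm z" for z
  proof -
    have "norm z \<le> norm (z - u) + 1"
      using norm_triangle_ineq[of "z - u" u] norming_pairD[OF np] by simp
    then have "r * norm z \<le> r * (norm (z - u) + 1)"
      using \<open>0 < r\<close> by (intro mult_left_mono) auto
    with z have "norm (z - u) * (1 - r) \<le> r" by (simp add: algebra_simps)
    also have "r \<le> \<epsilon> * (1 - r)" using r by (simp add: algebra_simps)
    finally have "norm (z - u) \<le> \<epsilon>" using \<open>r < 1\<close> by simp
    then show ?thesis by (simp add: dist_norm norm_minus_commute)
  qed
  then show ?thesis
    unfolding C_n_eq_cone_of[OF np \<open>0 < r\<close> \<open>r < 1\<close>] by (intro cone_of_mono) auto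
qed

section \<open>Convexity, closedness, properness and interior points\<close>

lemma convex_C_ax:
  assumes "0 < \<delta>"
  shows "convex (C_ax u f \<delta>)"
proof (rule convexI)
  fix x y and s t :: real
  assume x: "x \<in> C_ax u f \<delta>" and y: "y \<in> C_ax u f \<delta>" and "0 \<le> s" "0 \<le> t"
  then have "s *\<^sub>R x \<in> C_ax u f \<delta>" "t *\<^sub>R y \<in> C_ax u f \<delta>"
    using cone_C_ax[OF assms] by (auto simp: cone_def)
  \<comment> \<open>The bound on the deviation is linear in x, so the triangle inequality gives
    closure under addition. For \<open>C_n\<close> the bound r norm x is convex in x, and this
    argument breaks down.\<close>
  then show "s *\<^sub>R x + t *\<^sub>R y \<in> C_ax u f \<delta>"
    using norm_triangle_ineq[of "Q_map u f (s *\<^sub>R x)" "Q_map u f (t *\<^sub>R y)"]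
    by (simp add: C_ax_iff[OF assms] Q_map_add blinfun.add_right distrib_left)
qed

lemma closed_C_ax: "closed (C_ax u f \<delta>)"
  unfolding C_ax_def by (intro closed_Collect_le continuous_intros)

lemma closed_C_n: "closed (C_n u f r)"
  unfolding C_n_def by (intro closed_Collect_conj closed_Collect_le continuous_intros)

text \<open>The vector - u is left out because f takes the value -1 there, and \<open>u\<close> is a
  nonzero member.\<close>

lemma proper_cone_if_norming:
  assumes "norming_pair u f" "cone C" "u \<in> C" "\<And>x. x \<in> C \<Longrightarrow> 0 \<le> blinfun_apply f x"
  shows "proper_cone C"
proof -
  have "- u \<notin> C" using assms(4)[of "- u"] norming_pairD[OF assms(1)] by (auto simp: blinfun.minus_right)
  moreover have "0 \<in> C" using assms(2,3) cone_contains_0 by blast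
  moreover have "u \<noteq> 0" using norming_pairD[OF assms(1)] by auto
  ultimately show ?thesis using assms(2,3) by (auto simp: proper_cone_def)
qed

text \<open>The strict inequality cuts out an open set, and it holds at \<open>u\<close>, where the
  deviation vanishes and f is 1.\<close>

lemma interior_C_ax:
  assumes np: "norming_pair u f"
  shows "u \<in> interior (C_ax u f \<delta>)"
proof (rule interiorI)
  let ?U = "{x. 0 < blinfun_apply f x - inverse \<delta> * norm (Q_map u f x)}"
  show "open ?U" by (intro open_Collect_less continuous_intros)
  show "u \<in> ?U" using np by (simp add: Q_map_self norming_pairD)
  show "?U \<subseteq> C_ax u f \<delta>" by (auto simp: C_ax_def)
qed

lemma interior_C_n:
  assumes np: "norming_pair u f" and "0 < r"
  shows "u \<in> interior (C_n u f r)"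
proof (rule interiorI)
  let ?U = "{x. 0 < blinfun_apply f x \<and> norm (Q_map u f x) < r * norm x}"
  show "open ?U" by (intro open_Collect_conj open_Collect_less continuous_intros)
  show "u \<in> ?U" using assms by (simp add: Q_map_self norming_pairD)
  show "?U \<subseteq> C_n u f r" by (auto simp: C_n_def)
qed

lemma proper_cone_C_ax:
  assumes np: "norming_pair u f" and \<delta>: "0 < \<delta>"
  shows "proper_cone (C_ax u f \<delta>)"
proof (rule proper_cone_if_norming[OF np cone_C_ax[OF \<delta>]])
  show "u \<in> C_ax u f \<delta>" using interior_C_ax[OF np] interior_subset by blast
  fix x
  assume "x \<in> C_ax u f \<delta>"
  then have "norm (Q_map u f x) \<le> \<delta> * blinfun_apply f x" using \<delta> by (simp add: C_ax_iff)
  then have "0 \<le> \<delta> * blinfun_apply f x" by (rule order_trans[OF norm_ge_zero])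
  then show "0 \<le> blinfun_apply f x" using \<delta> by (simp add: zero_le_mult_iff)
qed

lemma proper_cone_C_n:
  assumes np: "norming_pair u f" and r: "0 < r"
  shows "proper_cone (C_n u f r)"
proof (rule proper_cone_if_norming[OF np cone_C_n])
  show "u \<in> C_n u f r" using interior_C_n[OF np r] interior_subset by blast
qed (simp add: C_n_def)

section \<open>Directional fineness of the two families\<close>

lemma convex_directionally_fine_F_ax:
  "convex_directionally_fine (F_ax :: 'a::real_normed_vector set set)"
  unfolding convex_directionally_fine_def
proof (intro conjI ballI)
  fix C :: "'a set"
  assume "C \<in> F_ax"
  then show "closed C" "proper_cone C"
    by (auto simp: F_ax_def closed_C_ax proper_cone_C_ax)
next
  fix u :: 'a and \<epsilon> :: real
  assume u: "u \<in> sphere 0 1" and \<epsilon>: "\<epsilon> \<in> {0<..<1}"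
  obtain f where np: "norming_pair u f" using norming_pair_exists[of u] u by auto
  have "0 < \<epsilon> / 2" using \<epsilon> by simp
  then have "C_ax u f (\<epsilon> / 2) \<in> F_ax" unfolding F_ax_def using np by blast
  moreover have "convex (C_ax u f (\<epsilon> / 2))" using \<epsilon> by (intro convex_C_ax) auto
  moreover have "C_ax u f (\<epsilon> / 2) \<subseteq> cone_of (cball u \<epsilon>)"
    using \<epsilon> by (intro C_ax_subset_cone_of_cball np) auto
  ultimately show "\<exists>C\<in>F_ax. convex C \<and> u \<in> interior C \<and> interior C \<subseteq> C \<and> C \<subseteq> cone_of (cball u \<epsilon>)"
    using interior_C_ax[OF np] interior_subset by blast
qed

lemma directionally_fine_if_convex: "convex_directionally_fine \<F> \<Longrightarrow> directionally_fine \<F>"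
  unfolding convex_directionally_fine_def directionally_fine_def by meson

lemma directionally_fine_F_n: "directionally_fine (F_n :: 'a::real_normed_vector set set)"
  unfolding directionally_fine_def
proof (intro conjI ballI)
  fix C :: "'a set"
  assume "C \<in> F_n"
  then show "closed C" "proper_cone C"
    by (auto simp: F_n_def closed_C_n proper_cone_C_n)
next
  fix u :: 'a and \<epsilon> :: real
  assume u: "u \<in> sphere 0 1" and \<epsilon>: "\<epsilon> \<in> {0<..<1}"
  obtain f where np: "norming_pair u f" using norming_pair_exists[of u] u by auto
    \<comment> \<open>The threshold is below 1, so an admissible \<open>r\<close> also meets the
      bound r < 1 required in \<open>F_n\<close>.\<close>
    have "0 < \<epsilon> / (1 + \<epsilon>)" "\<epsilon> / (1 + \<epsilon>) < 1" using \<epsilon> by auto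
  moreover then obtain r where r: "0 < r" "r < \<epsilon> / (1 + \<epsilon>)" using dense by blast
  ultimately have "r < 1" by linarith
  have "C_n u f r \<in> F_n" unfolding F_n_def using np r \<open>r < 1\<close> by blast
  moreover have "C_n u f r \<subseteq> cone_of (cball u \<epsilon>)"
    using \<epsilon> r by (intro C_n_subset_cone_of_cball np) auto
  ultimately show "\<exists>C\<in>F_n. u \<in> interior C \<and> interior C \<subseteq> C \<and> C \<subseteq> cone_of (cball u \<epsilon>)"
    using interior_C_n[OF np r(1)] interior_subset by blast
qed

section \<open>Hilbert spaces\<close>

text \<open>If f were nonzero at some y orthogonal to \<open>u\<close>, moving from \<open>u\<close>
  to u + t y would change f to first order in t but the squared norm only to second order, against f
  having norm 1. Hence f vanishes on the orthogonal complement of \<open>u\<close>.\<close>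

lemma norming_pair_inner:
  fixes u :: "'h::real_inner"
  assumes np: "norming_pair u f"
  shows "blinfun_apply f x = u \<bullet> x"
proof -
  note D = norming_pairD[OF np]
  define y where "y = x - (u \<bullet> x) *\<^sub>R u"
  have uu: "u \<bullet> u = 1" using D(1) by (simp add: dot_square_norm)
  have uy: "u \<bullet> y = 0" by (simp add: y_def inner_diff_right uu)
  define c where "c = blinfun_apply f y"
  define N where "N = y \<bullet> y"
  have N: "0 \<le> N" by (simp add: N_def)
  have ineq: "(1 + t * c)\<^sup>2 \<le> 1 + t\<^sup>2 * N" for t
  proof -
    have "\<bar>blinfun_apply f (u + t *\<^sub>R y)\<bar> \<le> norm (u + t *\<^sub>R y)"
      using norm_blinfun[of f "u + t *\<^sub>R y"] D(2) by simp
    then have "(blinfun_apply f (u + t *\<^sub>R y))\<^sup>2 \<le> (norm (u + t *\<^sub>R y))\<^sup>2"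
      by (metis abs_ge_zero power2_abs power_mono)
    also have "(norm (u + t *\<^sub>R y))\<^sup>2 = 1 + t\<^sup>2 * N"
      unfolding power2_norm_eq_inner
      by (simp add: inner_add inner_commute[of y u] uy uu N_def power2_eq_square)
    finally show ?thesis by (simp add: blinfun.add_right blinfun.scaleR_right D(3) c_def)
  qed
  have "c = 0"
  proof (rule ccontr)
    assume "c \<noteq> 0"
    \<comment> \<open>With this t, t c = t^2 (N + 1), so the linear gain 2 t c exceeds t^2 N. The
      summand 1 keeps the denominator positive when y = 0.\<close>
    define t where "t = c / (N + 1)"
    have tN: "t * (N + 1) = c" using N by (simp add: t_def)
    have "1 + (t * c)\<^sup>2 + 2 * (t * c) \<le> 1 + t\<^sup>2 * N"
      using ineq[of t] by (simp add: power2_sum)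
    moreover have "0 \<le> (t * c)\<^sup>2" by simp
    moreover have "t * c = t\<^sup>2 * N + t\<^sup>2"
      by (simp add: tN[symmetric] power2_eq_square algebra_simps)
    moreover have "0 < t\<^sup>2" using \<open>c \<noteq> 0\<close> N by (simp add: t_def)
    moreover have "0 \<le> t\<^sup>2 * N" using N by simp
    ultimately show False by linarith
  qed
  then show ?thesis by (simp add: c_def y_def blinfun.diff_right blinfun.scaleR_right D(3))
qed

lemma norm_Q_map_inner:
  fixes u :: "'h::real_inner"
  assumes np: "norming_pair u f"
  shows "(norm (Q_map u f x))\<^sup>2 = (norm x)\<^sup>2 - (blinfun_apply f x)\<^sup>2"
proof -
  have "u \<bullet> u = 1" using norming_pairD[OF np] by (simp add: dot_square_norm)
  then show ?thesis
    unfolding power2_norm_eq_inner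
    by (simp add: Q_map_def norming_pair_inner[OF np] inner_diff inner_commute[of x u]
        power2_eq_square)
qed

lemma C_n_eq_C_ax_inner:
  fixes u :: "'h::real_inner"
  assumes np: "norming_pair u f" and r: "0 < r" "r < 1"
  shows "C_n u f r = C_ax u f (r / sqrt (1 - r\<^sup>2))"
proof -
  define s where "s = sqrt (1 - r\<^sup>2)"
  have "r\<^sup>2 < 1" using r by (simp add: power_less_one_iff)
  then have s: "0 < s" "s\<^sup>2 = 1 - r\<^sup>2" by (auto simp: s_def)
  have rs: "0 < r / s" using r s by simp
  have "x \<in> C_n u f r \<longleftrightarrow> x \<in> C_ax u f (r / s)" for x
  proof (cases "0 \<le> blinfun_apply f x")
    case True
    let ?q = "norm (Q_map u f x)"
    let ?c = "blinfun_apply f x"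
    have "x \<in> C_n u f r \<longleftrightarrow> ?q\<^sup>2 \<le> (r * norm x)\<^sup>2"
      using True r by (simp add: C_n_def abs_le_square_iff[symmetric])
    \<comment> \<open>Pythagoras eliminates the norm of x. Collecting the deviation terms leaves the
      factor 1 - r^2 = s^2, whence the parameter r / s.\<close>
    also have "\<dots> \<longleftrightarrow> ?q\<^sup>2 \<le> r\<^sup>2 * (?q\<^sup>2 + ?c\<^sup>2)"
      by (simp add: norm_Q_map_inner[OF np] power_mult_distrib)
    also have "\<dots> \<longleftrightarrow> (s * ?q)\<^sup>2 \<le> (r * ?c)\<^sup>2"
      by (simp add: power_mult_distrib s(2) algebra_simps)
    also have "\<dots> \<longleftrightarrow> s * ?q \<le> r * ?c"
      using True r s by (simp add: abs_le_square_iff[symmetric] abs_mult)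
    also have "\<dots> \<longleftrightarrow> x \<in> C_ax u f (r / s)"
      using s by (simp add: C_ax_iff[OF rs] field_simps)
    finally show ?thesis .
  next
    case False
    \<comment> \<open>A point with f x < 0 lies in neither cone.\<close>
    then have "r / s * blinfun_apply f x < 0" using rs by (intro mult_pos_neg) auto
    then have "x \<notin> C_ax u f (r / s)"
      using norm_ge_zero[of "Q_map u f x"] by (simp add: C_ax_iff[OF rs] del: norm_ge_zero)
    with False show ?thesis by (simp add: C_n_def)
  qed
  then show ?thesis by (auto simp: s_def)
qed

text \<open>The inverse comes from solving d^2 = r^2 / (1 - r^2) for r. Surjectivity is what puts
  every axial cone of an inner product space into \<open>F_n\<close>.\<close>

lemma bij_betw_reparametrization: "bij_betw (\<lambda>r::real. r / sqrt (1 - r\<^sup>2)) {0<..<1} {0<..}"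
proof (rule bij_betwI[where g = "\<lambda>d. d / sqrt (1 + d\<^sup>2)"])
  have less: "r\<^sup>2 < 1" if "0 < r" "r < 1" for r :: real
    using that by (simp add: power_less_one_iff)
  show "(\<lambda>r::real. r / sqrt (1 - r\<^sup>2)) \<in> {0<..<1} \<rightarrow> {0<..}"
    using less by auto
  show "(\<lambda>d::real. d / sqrt (1 + d\<^sup>2)) \<in> {0<..} \<rightarrow> {0<..<1}"
    by (auto simp: add_pos_nonneg intro!: real_less_rsqrt)
  show "r / sqrt (1 - r\<^sup>2) / sqrt (1 + (r / sqrt (1 - r\<^sup>2))\<^sup>2) = r" if "r \<in> {0<..<1}" for r :: real
  proof -
    have "r\<^sup>2 < 1" using less that by auto
    then have "1 + (r / sqrt (1 - r\<^sup>2))\<^sup>2 = 1 / (1 - r\<^sup>2)"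
      by (simp add: power_divide field_simps)
    then show ?thesis using \<open>r\<^sup>2 < 1\<close> by (simp add: real_sqrt_divide)
  qed
  show "d / sqrt (1 + d\<^sup>2) / sqrt (1 - (d / sqrt (1 + d\<^sup>2))\<^sup>2) = d" if "d \<in> {0<..}" for d :: real
  proof -
    have pos: "0 < 1 + d\<^sup>2" by (simp add: add_pos_nonneg)
    then have "1 - (d / sqrt (1 + d\<^sup>2))\<^sup>2 = 1 / (1 + d\<^sup>2)"
      by (simp add: power_divide field_simps)
    then show ?thesis using pos by (simp add: real_sqrt_divide)
  qed
qed

lemma F_n_eq_F_ax_inner: "(F_n :: 'h::real_inner set set) = F_ax"
proof -
  let ?h = "\<lambda>r::real. r / sqrt (1 - r\<^sup>2)"
  have im: "?h ` {0<..<1} = {0<..}"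
    using bij_betw_reparametrization by (rule bij_betw_imp_surj_on)
  show ?thesis
  proof (intro equalityI subsetI)
    fix C :: "'h set"
    assume "C \<in> F_n"
    then obtain u f r where C: "C = C_n u f r" "norming_pair u f" "0 < r" "r < 1"
      by (auto simp: F_n_def)
    then have "0 < ?h r" using im by auto
    with C show "C \<in> F_ax" unfolding F_ax_def using C_n_eq_C_ax_inner by blast
  next
    fix C :: "'h set"
    assume "C \<in> F_ax"
    then obtain u f \<delta> where C: "C = C_ax u f \<delta>" "norming_pair u f" "0 < \<delta>"
      by (auto simp: F_ax_def)
    then have "\<delta> \<in> ?h ` {0<..<1}" unfolding im by simp
    then obtain r where "0 < r" "r < 1" "\<delta> = ?h r" by auto
    with C show "C \<in> F_n" unfolding F_n_def using C_n_eq_C_ax_inner by blast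
  qed
qed

section \<open>A non-convex cone in the space of bounded sequences\<close>

text \<open>On the discrete space of naturals every function is continuous, so boundedness alone
  makes h an element of \<open>linfty\<close>.\<close>

lemma linfty_of_fun:
  fixes h :: "nat \<Rightarrow> real"
  assumes "\<And>n. \<bar>h n\<bar> \<le> b"
  shows "apply_bcontfun (Bcontfun h :: linfty) = h"
  by (rule Bcontfun_inverse, rule bcontfun_normI) (use assms in auto)

lemma linfty_norm_eqI:
  fixes x :: linfty
  assumes "\<And>n. \<bar>apply_bcontfun x n\<bar> \<le> b" "\<bar>apply_bcontfun x k\<bar> = b"
  shows "norm x = b"
  using norm_bounded[of x k] norm_bound[of x b] assms by (intro antisym) auto

lemma linfty_not_convex_C_n:
  obtains u :: linfty and f where "norming_pair u f" "\<not> convex (C_n u f (1/2))"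
proof -
  define u :: linfty where "u = const_bcontfun 1"
  define e :: "linfty \<Rightarrow> real" where "e x = apply_bcontfun x 0" for x
  have bl: "bounded_linear e"
    unfolding e_def using norm_bounded[where 'a = nat and 'b = real]
    by (intro bounded_linear_intro[where K = 1]) auto
  define f where "f = Blinfun e"
  have f: "blinfun_apply f x = apply_bcontfun x 0" for x
    by (simp add: f_def bounded_linear_Blinfun_apply[OF bl] e_def)
  have nu: "norm u = 1" by (rule linfty_norm_eqI[of _ _ 0]) (auto simp: u_def)
  have "norm f = 1"
    using norm_bounded[where 'a = nat and 'b = real] nu
    by (intro norm_blinfun_eqI[where x = u]) (auto simp: f u_def)
  with nu have np: "norming_pair u f" by (simp add: norming_pair_def f u_def)
  \<comment> \<open>The points are x 1 = (1, 2, 0, 1, 1, ...) and x 3 = (1, 1, 0, 2, 1, ...). Each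
    has norm 2 and deviation 1. In the midpoint the common entry 0 keeps the deviation at 1, while
    the peaks at different places average out and the norm drops to 3/2; but 1 > 3/4.\<close>
  define h where "h i n = (if n = i then 2 else if n = 2 then 0 else 1 :: real)" for i n :: nat
  define x :: "nat \<Rightarrow> linfty" where "x i = Bcontfun (h i)" for i
  have x: "apply_bcontfun (x i) = h i" for i
    unfolding x_def by (rule linfty_of_fun[where b = 2]) (simp add: h_def)
  have mem: "x i \<in> C_n u f (1/2)" if "i = 1 \<or> i = 3" for i
  proof -
    have "norm (x i) = 2" by (rule linfty_norm_eqI[of _ _ i]) (auto simp: x h_def)
    moreover have "norm (Q_map u f (x i)) = 1"
      using that by (intro linfty_norm_eqI[of _ _ 2]) (auto simp: Q_map_def x f u_def h_def)
    ultimately show ?thesis using that by (auto simp: C_n_def f x h_def)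
  qed
  have "(1/2) *\<^sub>R x 1 + (1/2) *\<^sub>R x 3 \<notin> C_n u f (1/2)"
  proof -
    let ?y = "(1/2) *\<^sub>R x 1 + (1/2) *\<^sub>R x 3"
    have "norm ?y = 3/2" by (rule linfty_norm_eqI[of _ _ 1]) (auto simp: x h_def)
    moreover have "norm (Q_map u f ?y) = 1"
      by (rule linfty_norm_eqI[of _ _ 2]) (auto simp: Q_map_def x f u_def h_def)
    ultimately show ?thesis by (simp add: C_n_def)
  qed
  with mem have "\<not> convex (C_n u f (1/2))"
    unfolding convex_def by (metis field_sum_of_halves half_gt_zero_iff less_eq_real_def zero_less_one)
  with np show thesis by (rule that)
qed

theorem corollary5p6:
  "directionally_fine (F_ax :: 'a::real_normed_vector set set) \<and>
   directionally_fine (F_n :: 'a set set) \<and>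
   convex_directionally_fine (F_ax :: 'a set set) \<and>
   (\<forall>(u::'a) f \<epsilon> \<delta>. norming_pair u f \<and> 0 < \<epsilon> \<and> \<epsilon> < 1 \<and> 0 < \<delta> \<and> \<delta> < \<epsilon> \<longrightarrow>
      C_ax u f \<delta> \<subseteq> cone_of (cball u \<epsilon>)) \<and>
   (\<forall>(u::'a) f \<epsilon> r. norming_pair u f \<and> 0 < \<epsilon> \<and> \<epsilon> < 1 \<and> 0 < r \<and> r < \<epsilon> / (1 + \<epsilon>) \<longrightarrow>
      C_n u f r \<subseteq> cone_of (cball u \<epsilon>)) \<and>
   (\<forall>(u::'a) f \<delta>. norming_pair u f \<and> 0 < \<delta> \<longrightarrow>
      C_ax u f \<delta> = cone_of ((+) u ` ker f \<inter> cball u \<delta>)) \<and>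
   (\<forall>(u::'a) f r. norming_pair u f \<and> 0 < r \<and> r < 1 \<longrightarrow>
      C_n u f r = cone_of ((+) u ` ker f \<inter> {z. norm (z - u) \<le> r * norm z})) \<and>
   (\<forall>(u::'h::{real_inner,complete_space}) f r. norming_pair u f \<and> 0 < r \<and> r < 1 \<longrightarrow>
      C_n u f r = C_ax u f (r / sqrt (1 - r\<^sup>2))) \<and>
   bij_betw (\<lambda>r::real. r / sqrt (1 - r\<^sup>2)) {0<..<1} {0<..} \<and>
   (F_n :: 'h set set) = F_ax \<and>
   (F_n :: linfty set set) \<noteq> F_ax \<and>
   (\<exists>(u::linfty) f r. norming_pair u f \<and> 0 < r \<and> r < 1 \<and>
      (\<forall>\<delta>>0. C_n u f r \<noteq> C_ax u f \<delta>))"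
proof -
  obtain u :: linfty and f where np: "norming_pair u f" and nc: "\<not> convex (C_n u f (1/2))"
    by (rule linfty_not_convex_C_n)
  \<comment> \<open>Convexity rules out every axial cone at once, for any norming pair and any
    \<delta> > 0. So this one cone separates the families and also refutes a reparametrization with
    \<open>u\<close> and \<open>f\<close> fixed.\<close>
  have ne: "C_n u f (1/2) \<noteq> C_ax v g \<delta>" if "0 < \<delta>" for v g \<delta>
    using nc convex_C_ax[OF that] by metis
  have "C_n u f (1/2) \<in> F_n"
    unfolding F_n_def using np by (intro CollectI exI[of _ u] exI[of _ f] exI[of _ "1/2"]) simp
  moreover have "C_n u f (1/2) \<notin> F_ax" using ne by (auto simp: F_ax_def)
  ultimately have neq: "(F_n :: linfty set set) \<noteq> F_ax" by metis
  have ex: "\<exists>(u::linfty) f r. norming_pair u f \<and> 0 < r \<and> r < 1 \<and> (\<forall>\<delta>>0. C_n u f r \<noteq> C_ax u f \<delta>)"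
    using np ne by (intro exI[of _ u] exI[of _ f] exI[of _ "1/2"]) simp
  show ?thesis
    by (intro conjI allI impI neq ex convex_directionally_fine_F_ax directionally_fine_F_n
        directionally_fine_if_convex bij_betw_reparametrization F_n_eq_F_ax_inner)
      (elim conjE, (rule C_ax_subset_cone_of_cball C_n_subset_cone_of_cball
          C_ax_eq_cone_of C_n_eq_cone_of C_n_eq_C_ax_inner; assumption))+
qed

end
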